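(* Let $\kappa<\lambda$ be regular uncountable cardinals and suppose there is a simple $P_\lambda$-point on $\kappa$. Then $$\mathfrak{u}_\kappa=\mathfrak{u}^{com}_\kappa=\mathfrak{b}_\kappa=\mathfrak{d}_\kappa=\mathfrak{s}_\kappa=\mathfrak{r}_\kappa=\lambda.$$ In particular, if $\mu\neq\lambda$ is a regular cardinal, then there is no simple $P_\mu$-point on $\kappa$.
   Context: For $A,B\subseteq\kappa$, $A\subseteq^* B$ means there is $\alpha<\kappa$ with $A\setminus\alpha\subseteq B$. An ultrafilter on $\kappa$ is uniform if all its members have cardinality $\kappa$. A base of an ultrafilter $U$ on $\kappa$ is a family $\mathcal B\subseteq U$ such that every $A\in U$ has some $B\in\mathcal B$ with $B\subseteq^* A$; the character $\mathfrak{ch}(U)$ is the least size of a base. A simple $P_\lambda$-point on $\kappa$ is a uniform ultrafilter $U$ on $\kappa$ having a $\subseteq^*$-decreasing sequence $\langle X_i: i<\lambda\rangle\subseteq U$ (i.e. $X_j\subseteq^* X_i$ for $i<j$) that is a base for $U$. For $f,g:\kappa\to\kappa$, $f\le^* g$ iff there is $\alpha<\kappa$ with $f(\beta)\le g(\beta)$ for all $\beta\ge\alpha$. $\mathfrak b_\kappa$ is the least size of a $\le^*$-unbounded family in ${}^\kappa\kappa$; $\mathfrak d_\kappa$ is the least size of a $\le^*$-dominating family in ${}^\kappa\kappa$. $\mathfrak u_\kappa=\min\{\mathfrak{ch}(U): U$ a uniform ultrafilter on $\kappa\}$ and $\mathfrak u^{com}_\kappa=\min\{\mathfrak{ch}(U):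 U$ a $\kappa$-complete uniform ultrafilter on $\kappa\}$. A set $A$ splits $B$ if $A\cap B$ and $B\setminus A$ are both unbounded in $\kappa$. $\mathfrak s_\kappa$ is the least size of a family $\mathcal A\subseteq[\kappa]^\kappa$ such that every $X\in[\kappa]^\kappa$ is split by some member of $\mathcal A$; $\mathfrak r_\kappa$ is the least size of a family $\mathcal A\subseteq[\kappa]^\kappa$ such that no single $X\subseteq\kappa$ splits every member of $\mathcal A$. *)

theory Defs
  imports Main "HOL-Library.FuncSet"
begin

unbundle cardinal_syntax

text \<open>
  Cardinals are represented by the card-orders of the library: for a card-order
  \<open>\<kappa>\<close>, the ordinals below \<open>\<kappa>\<close> are the elements of \<^term>\<open>Field \<kappa>\<close>, \<^prop>\<open>(\<alpha>, \<beta>) \<in> \<kappa>\<close> is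
  \<open>\<alpha> \<le> \<beta>\<close>, and an ordinal \<open>\<alpha> < \<kappa>\<close>, viewed as the set of its predecessors, is
  \<^term>\<open>underS \<kappa> \<alpha>\<close>.  Equality and comparison of cardinals are \<open>=o\<close>, \<open>\<le>o\<close>, \<open><o\<close>.
  For a limit order, a subset of \<^term>\<open>Field \<kappa>\<close> is unbounded iff it is \<^const>\<open>cofinal\<close>.
\<close>

definition regular_cardinal :: "'a rel \<Rightarrow> bool" where
  "regular_cardinal \<kappa> \<longleftrightarrow> Cinfinite \<kappa> \<and> regularCard \<kappa>"

definition uncountable_cardinal :: "'a rel \<Rightarrow> bool" where
  "uncountable_cardinal \<kappa> \<longleftrightarrow> Card_order \<kappa> \<and> natLeq <o \<kappa>"

text \<open>
  The least cardinal in a class of card-orders, determined up to \<open>=o\<close>.  The value on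
  the empty class is zero, so that \<open>min_card S =o \<kappa>\<close> for an infinite \<open>\<kappa>\<close>
  entails that \<open>S\<close> is nonempty.
\<close>

definition min_card :: "'a rel set \<Rightarrow> 'a rel" where
  "min_card S = (if S = {} then czero else (SOME r. r \<in> S \<and> (\<forall>s\<in>S. r \<le>o s)))"

lemma min_card_least:
  assumes "S \<noteq> {}" and "\<forall>r\<in>S. Card_order r"
  shows "min_card S \<in> S" and "\<forall>s\<in>S. min_card S \<le>o s"
proof -
  have "\<exists>r. r \<in> S \<and> (\<forall>s\<in>S. r \<le>o s)"
    using exists_minim_Card_order[OF assms] by blast
  from someI_ex[OF this] show "min_card S \<in> S" and "\<forall>s\<in>S. min_card S \<le>o s"
    using assms(1) by (auto simp: min_card_def)
qed

definition almost_subset :: "'a rel \<Rightarrow> 'a set \<Rightarrow> 'a set \<Rightarrow> bool" where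
  "almost_subset \<kappa> A B \<longleftrightarrow> (\<exists>\<alpha>\<in>Field \<kappa>. A - underS \<kappa> \<alpha> \<subseteq> B)"

definition full_subsets :: "'a rel \<Rightarrow> 'a set set" where  \<comment> \<open>\<open>[\<kappa>]\<^sup>\<kappa>\<close>\<close>
  "full_subsets \<kappa> = {X. X \<subseteq> Field \<kappa> \<and> |X| =o \<kappa>}"

definition ultrafilter_on :: "'a set \<Rightarrow> 'a set set \<Rightarrow> bool" where
  "ultrafilter_on S U \<longleftrightarrow>
     U \<subseteq> Pow S \<and> S \<in> U \<and> {} \<notin> U \<and>
     (\<forall>A\<in>U. \<forall>B\<in>U. A \<inter> B \<in> U) \<and>
     (\<forall>A\<in>U. \<forall>B. A \<subseteq> B \<and> B \<subseteq> S \<longrightarrow> B \<in> U) \<and>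
     (\<forall>A. A \<subseteq> S \<longrightarrow> A \<in> U \<or> S - A \<in> U)"

definition uniform_ultrafilter :: "'a rel \<Rightarrow> 'a set set \<Rightarrow> bool" where
  "uniform_ultrafilter \<kappa> U \<longleftrightarrow> ultrafilter_on (Field \<kappa>) U \<and> (\<forall>A\<in>U. |A| =o \<kappa>)"

definition complete_family :: "'a rel \<Rightarrow> 'a set set \<Rightarrow> bool" where
  "complete_family \<kappa> U \<longleftrightarrow> (\<forall>F. F \<subseteq> U \<and> F \<noteq> {} \<and> |F| <o \<kappa> \<longrightarrow> \<Inter>F \<in> U)"

definition uf_base :: "'a rel \<Rightarrow> 'a set set \<Rightarrow> 'a set set \<Rightarrow> bool" where
  "uf_base \<kappa> U \<B> \<longleftrightarrow> \<B> \<subseteq> U \<and> (\<forall>A\<in>U. \<exists>B\<in>\<B>. almost_subset \<kappa> B A)"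

definition char_uf :: "'a rel \<Rightarrow> 'a set set \<Rightarrow> 'a set rel" where
  "char_uf \<kappa> U = min_card {|\<B>| |\<B>. uf_base \<kappa> U \<B>}"

text \<open>Simple \<open>P\<^sub>\<lambda>\<close>-points on \<open>\<kappa>\<close>; the sequence is indexed by the ordinals below \<open>\<lambda>\<close>.\<close>

definition simple_P_point :: "'b rel \<Rightarrow> 'a rel \<Rightarrow> 'a set set \<Rightarrow> bool" where
  "simple_P_point lam \<kappa> U \<longleftrightarrow>
     uniform_ultrafilter \<kappa> U \<and>
     (\<exists>X. (\<forall>i\<in>Field lam. X i \<in> U) \<and>
          (\<forall>i j. (i, j) \<in> lam \<and> i \<noteq> j \<longrightarrow> almost_subset \<kappa> (X j) (X i)) \<and>
          uf_base \<kappa> U (X ` Field lam))"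

definition self_maps :: "'a rel \<Rightarrow> ('a \<Rightarrow> 'a) set" where
  "self_maps \<kappa> = Field \<kappa> \<rightarrow>\<^sub>E Field \<kappa>"

definition le_star :: "'a rel \<Rightarrow> ('a \<Rightarrow> 'a) \<Rightarrow> ('a \<Rightarrow> 'a) \<Rightarrow> bool" where
  "le_star \<kappa> f g \<longleftrightarrow> (\<exists>\<alpha>\<in>Field \<kappa>. \<forall>\<beta>. (\<alpha>, \<beta>) \<in> \<kappa> \<longrightarrow> (f \<beta>, g \<beta>) \<in> \<kappa>)"

definition unbounded_family :: "'a rel \<Rightarrow> ('a \<Rightarrow> 'a) set \<Rightarrow> bool" where
  "unbounded_family \<kappa> F \<longleftrightarrow>
     F \<subseteq> self_maps \<kappa> \<and> \<not> (\<exists>g\<in>self_maps \<kappa>. \<forall>f\<in>F. le_star \<kappa> f g)"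

definition dominating_family :: "'a rel \<Rightarrow> ('a \<Rightarrow> 'a) set \<Rightarrow> bool" where
  "dominating_family \<kappa> F \<longleftrightarrow>
     F \<subseteq> self_maps \<kappa> \<and> (\<forall>f\<in>self_maps \<kappa>. \<exists>g\<in>F. le_star \<kappa> f g)"

definition splits :: "'a rel \<Rightarrow> 'a set \<Rightarrow> 'a set \<Rightarrow> bool" where
  "splits \<kappa> A B \<longleftrightarrow> cofinal (A \<inter> B) \<kappa> \<and> cofinal (B - A) \<kappa>"

definition splitting_family :: "'a rel \<Rightarrow> 'a set set \<Rightarrow> bool" where
  "splitting_family \<kappa> \<A> \<longleftrightarrow>
     \<A> \<subseteq> full_subsets \<kappa> \<and> (\<forall>X\<in>full_subsets \<kappa>. \<exists>A\<in>\<A>. splits \<kappa> A X)"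

definition unsplit_family :: "'a rel \<Rightarrow> 'a set set \<Rightarrow> bool" where
  "unsplit_family \<kappa> \<A> \<longleftrightarrow>
     \<A> \<subseteq> full_subsets \<kappa> \<and> \<not> (\<exists>X. X \<subseteq> Field \<kappa> \<and> (\<forall>A\<in>\<A>. splits \<kappa> X A))"

definition b_card :: "'a rel \<Rightarrow> ('a \<Rightarrow> 'a) rel" where
  "b_card \<kappa> = min_card {|F| |F. unbounded_family \<kappa> F}"

definition d_card :: "'a rel \<Rightarrow> ('a \<Rightarrow> 'a) rel" where
  "d_card \<kappa> = min_card {|F| |F. dominating_family \<kappa> F}"

definition s_card :: "'a rel \<Rightarrow> 'a set rel" where
  "s_card \<kappa> = min_card {|\<A>| |\<A>. splitting_family \<kappa> \<A>}"

definition r_card :: "'a rel \<Rightarrow> 'a set rel" where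
  "r_card \<kappa> = min_card {|\<A>| |\<A>. unsplit_family \<kappa> \<A>}"

definition u_card :: "'a rel \<Rightarrow> 'a set rel" where
  "u_card \<kappa> = min_card {char_uf \<kappa> U |U. uniform_ultrafilter \<kappa> U}"

definition u_com_card :: "'a rel \<Rightarrow> 'a set rel" where
  "u_com_card \<kappa> =
     min_card {char_uf \<kappa> U |U. uniform_ultrafilter \<kappa> U \<and> complete_family \<kappa> U}"

end

theory Submission
  imports Defs
begin

text \<open>
  Since \<open>\<lambda>\<close> is regular, fewer than \<open>\<lambda>\<close> members of a simple \<open>P\<^sub>\<lambda>\<close>-point \<open>U\<close> have a
  pseudo-intersection in \<open>U\<close>; as \<open>\<lambda> > \<kappa>\<close> this makes \<open>U\<close> \<open>\<kappa>\<close>-complete, and it also gives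
  \<open>\<s>\<^sub>\<kappa> \<ge> \<lambda>\<close>.  Because \<open>\<kappa>\<close> is uncountable, the order of functions modulo \<open>U\<close> is well-founded;
  let \<open>f\<close> be a minimal function which is unbounded modulo \<open>U\<close> (it represents \<open>\<kappa>\<close> in the
  ultrapower).  By minimality, for every \<open>g : \<kappa> \<rightarrow> \<kappa>\<close> the points \<open>x\<close> such that \<open>f x\<close> is closed
  under \<open>g\<close> form a set in \<open>U\<close>.  Hence, if \<open>A \<in> U\<close> is almost contained in this set, then
  sending \<open>\<beta>\<close> to some \<open>f x > \<beta>\<close> with \<open>x \<in> A\<close> eventually dominates \<open>g\<close>.  This yields
  \<open>\<b>\<^sub>\<kappa> \<ge> \<lambda>\<close> and \<open>\<d>\<^sub>\<kappa> \<le> \<lambda>\<close>.  The remaining inequalities are \<open>\<s>\<^sub>\<kappa> \<le> \<d>\<^sub>\<kappa>\<close>, \<open>\<b>\<^sub>\<kappa> \<le> \<r>\<^sub>\<kappa>\<close> and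
  \<open>\<r>\<^sub>\<kappa> \<le> \<u>\<^sub>\<kappa> \<le> \<u>\<^sub>\<kappa>\<^sup>c\<^sup>o\<^sup>m \<le> \<lambda>\<close>.
\<close>

section \<open>Least cardinals and almost inclusion\<close>

lemma min_card_ordIsoI:
  assumes "\<And>r. r \<in> S \<Longrightarrow> Card_order r" and "\<And>r. r \<in> S \<Longrightarrow> lam \<le>o r"
    and "r \<in> S" and "r \<le>o lam"
  shows "min_card S =o lam"
proof -
  have ne: "S \<noteq> {}" and co: "\<forall>r\<in>S. Card_order r" using assms by auto
  note m = min_card_least[OF ne co]
  have "min_card S \<le>o lam" using m(2) assms(3,4) ordLeq_transitive by blast
  then show ?thesis using m(1) assms(2) ordIso_iff_ordLeq by blast
qed

lemma almost_subset_trans: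
  assumes "Well_order \<kappa>" "almost_subset \<kappa> A B" "almost_subset \<kappa> B C"
  shows "almost_subset \<kappa> A C"
proof -
  obtain a b where a: "a \<in> Field \<kappa>" "A - underS \<kappa> a \<subseteq> B"
    and b: "b \<in> Field \<kappa>" "B - underS \<kappa> b \<subseteq> C"
    using assms(2,3) unfolding almost_subset_def by blast
  \<comment> \<open>Initial segments of a well-order are comparable, so removing the larger one
    serves both inclusions.\<close>
  have "underS \<kappa> a \<subseteq> underS \<kappa> b \<or> underS \<kappa> b \<subseteq> underS \<kappa> a"
    using wo_rel.ofilter_linord[of \<kappa>] wo_rel.underS_ofilter[of \<kappa>] assms(1)
    by (simp add: wo_rel_def)
  then show ?thesis using a b unfolding almost_subset_def by blast
qed

section \<open>Regular cardinals as well-orders\<close>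

locale regular_order =
  fixes \<kappa> :: "'a rel"
  assumes regular: "regular_cardinal \<kappa>"
begin

abbreviation lt :: "'a \<Rightarrow> 'a \<Rightarrow> bool"  (infix "\<sqsubset>" 50) where
  "a \<sqsubset> b \<equiv> a \<in> underS \<kappa> b"

lemma Card: "Card_order \<kappa>" and infinite_Field: "infinite (Field \<kappa>)"
  and WO: "Well_order \<kappa>"
  using regular card_order_on_well_order_on
  by (auto simp: regular_cardinal_def cinfinite_def)

lemma lt_iff: "a \<sqsubset> b \<longleftrightarrow> (a, b) \<in> \<kappa> \<and> a \<noteq> b"
  by (auto simp: underS_def)

lemma lt_Field: "a \<sqsubset> b \<Longrightarrow> a \<in> Field \<kappa>" "a \<sqsubset> b \<Longrightarrow> b \<in> Field \<kappa>"
  by (auto simp: lt_iff Field_def)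

lemma trans: "(a, b) \<in> \<kappa> \<Longrightarrow> (b, c) \<in> \<kappa> \<Longrightarrow> (a, c) \<in> \<kappa>"
  using WO by (meson order_on_defs transE)

lemma antisym: "(a, b) \<in> \<kappa> \<Longrightarrow> (b, a) \<in> \<kappa> \<Longrightarrow> a = b"
  using WO by (meson order_on_defs antisymD)

lemma refl: "a \<in> Field \<kappa> \<Longrightarrow> (a, a) \<in> \<kappa>"
  using WO by (meson order_on_defs refl_onD)

lemma lt_or_le: "a \<in> Field \<kappa> \<Longrightarrow> b \<in> Field \<kappa> \<Longrightarrow> a \<sqsubset> b \<or> (b, a) \<in> \<kappa>"
  using WO refl by (metis order_on_defs total_on_def lt_iff)

lemma lt_imp_le: "a \<sqsubset> b \<Longrightarrow> (a, b) \<in> \<kappa>"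
  by (simp add: lt_iff)

lemma lt_le_trans: "a \<sqsubset> b \<Longrightarrow> (b, c) \<in> \<kappa> \<Longrightarrow> a \<sqsubset> c"
  and le_lt_trans: "(a, b) \<in> \<kappa> \<Longrightarrow> b \<sqsubset> c \<Longrightarrow> a \<sqsubset> c"
  unfolding lt_iff by (metis trans antisym)+

lemma lt_trans: "a \<sqsubset> b \<Longrightarrow> b \<sqsubset> c \<Longrightarrow> a \<sqsubset> c"
  using lt_le_trans lt_imp_le by blast

lemma not_lt_self: "\<not> a \<sqsubset> a"
  by (simp add: lt_iff)

lemma wf_lt: "wf (\<kappa> - Id)"
  using WO by (simp add: order_on_defs)

lemma ex_gt:
  assumes "a \<in> Field \<kappa>" obtains b where "a \<sqsubset> b"
  using infinite_Card_order_limit[OF Card infinite_Field assms] by (auto simp: lt_iff)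

text \<open>Regularity gives every cofinal set full cardinality, so a small set is not cofinal.
  Moving from a weak bound to a point above it makes the bound strict.\<close>

lemma bounded_if_small:
  assumes "K \<subseteq> Field \<kappa>" "|K| <o \<kappa>"
  obtains b where "b \<in> Field \<kappa>" "\<And>a. a \<in> K \<Longrightarrow> a \<sqsubset> b"
proof -
  have "\<not> cofinal K \<kappa>"
    using assms regular not_ordLess_ordIso
    unfolding regular_cardinal_def regularCard_def by blast
  then obtain c where c: "c \<in> Field \<kappa>" "\<forall>b\<in>K. \<not> c \<sqsubset> b"
    by (auto simp: cofinal_def lt_iff)
  obtain b where b: "c \<sqsubset> b" using ex_gt c(1) by blast
  have "a \<sqsubset> b" if "a \<in> K" for a
    using lt_or_le[OF c(1), of a] c that assms(1) b le_lt_trans by blast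
  then show thesis using that lt_Field(2)[OF b] by blast
qed

lemma small_underS: "a \<in> Field \<kappa> \<Longrightarrow> |underS \<kappa> a| <o \<kappa>"
  using card_of_underS[OF Card] .

lemma bounded_image_underS:
  assumes "a \<in> Field \<kappa>" "\<And>x. x \<sqsubset> a \<Longrightarrow> g x \<in> Field \<kappa>"
  obtains b where "b \<in> Field \<kappa>" "\<And>x. x \<sqsubset> a \<Longrightarrow> g x \<sqsubset> b"
proof -
  have "|g ` underS \<kappa> a| <o \<kappa>"
    using card_of_image small_underS[OF assms(1)] ordLeq_ordLess_trans by blast
  moreover have "g ` underS \<kappa> a \<subseteq> Field \<kappa>" using assms(2) by blast
  ultimately show thesis using bounded_if_small that by (metis imageI)
qed

lemma ex_gt2:
  assumes "a \<in> Field \<kappa>" "b \<in> Field \<kappa>"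
  obtains c where "a \<sqsubset> c" "b \<sqsubset> c"
  using lt_or_le[OF assms] ex_gt[OF assms(1)] ex_gt[OF assms(2)] lt_trans le_lt_trans
  by metis

lemma not_cofinal_underS: "a \<in> Field \<kappa> \<Longrightarrow> A \<subseteq> underS \<kappa> a \<Longrightarrow> \<not> cofinal A \<kappa>"
  by (metis cofinal_def lt_iff antisym subsetD)

text \<open>Trades size for unboundedness: a bounded set lies in a proper initial segment, which is
  smaller than a cardinal, and regularity gives the other direction.\<close>

lemma full_subsets_iff: "A \<in> full_subsets \<kappa> \<longleftrightarrow> A \<subseteq> Field \<kappa> \<and> cofinal A \<kappa>"
proof -
  have "cofinal A \<kappa>" if A: "A \<subseteq> Field \<kappa>" "|A| =o \<kappa>"
  proof (rule ccontr)
    assume "\<not> cofinal A \<kappa>"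
    then obtain c where c: "c \<in> Field \<kappa>" "\<forall>b\<in>A. \<not> c \<sqsubset> b"
      by (auto simp: cofinal_def lt_iff)
    obtain b where b: "c \<sqsubset> b" using ex_gt c(1) by blast
    have "A \<subseteq> underS \<kappa> b"
      using lt_or_le[OF c(1)] c A(1) b le_lt_trans by blast
    then have "|A| <o \<kappa>"
      using small_underS[OF lt_Field(2)[OF b]] card_of_mono1 ordLeq_ordLess_trans by blast
    then show False using A(2) not_ordLess_ordIso by blast
  qed
  moreover have "|A| =o \<kappa>" if "A \<subseteq> Field \<kappa>" "cofinal A \<kappa>"
    using that regular unfolding regular_cardinal_def regularCard_def by blast
  ultimately show ?thesis by (auto simp: full_subsets_def)
qed

lemma ex_in_cofinal:
  assumes "cofinal A \<kappa>" "a \<in> Field \<kappa>"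
  obtains b where "b \<in> A" "a \<sqsubset> b"
  using assms by (auto simp: cofinal_def lt_iff)

lemma cofinalI:
  assumes "\<And>a. a \<in> Field \<kappa> \<Longrightarrow> \<exists>b\<in>A. a \<sqsubset> b"
  shows "cofinal A \<kappa>"
  using assms unfolding cofinal_def lt_iff by metis

lemma not_splits_if_almost_subset:
  assumes "almost_subset \<kappa> B A \<or> almost_subset \<kappa> B (Field \<kappa> - A)"
  shows "\<not> splits \<kappa> A B"
proof -
  have "\<exists>a\<in>Field \<kappa>. B - A \<subseteq> underS \<kappa> a \<or> A \<inter> B \<subseteq> underS \<kappa> a"
    using assms unfolding almost_subset_def by blast
  then show ?thesis unfolding splits_def using not_cofinal_underS by blast
qed

lemma almost_subset_refl: "almost_subset \<kappa> A A"
  unfolding almost_subset_def using infinite_Field by (metis Diff_subset ex_in_conv finite.emptyI)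

subsection \<open>Splitting and domination\<close>

text \<open>Restricted to \<open>Field \<kappa>\<close> because \<open>self_maps\<close> consists of
  extensional functions. Any choice of a later element serves; leastness is not asked for.\<close>

definition next_in :: "'a set \<Rightarrow> 'a \<Rightarrow> 'a" where
  "next_in A = (\<lambda>\<beta>\<in>Field \<kappa>. SOME \<gamma>. \<gamma> \<in> A \<and> \<beta> \<sqsubset> \<gamma>)"

lemma next_in:
  assumes "cofinal A \<kappa>" "b \<in> Field \<kappa>"
  shows "next_in A b \<in> A" "b \<sqsubset> next_in A b"
proof -
  have "\<exists>\<gamma>. \<gamma> \<in> A \<and> b \<sqsubset> \<gamma>" using ex_in_cofinal[OF assms] by blast
  from someI_ex[OF this] show "next_in A b \<in> A" "b \<sqsubset> next_in A b"
    using assms(2) by (simp_all add: next_in_def)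
qed

lemma next_in_self_maps: "cofinal A \<kappa> \<Longrightarrow> next_in A \<in> self_maps \<kappa>"
  using lt_Field(2)[OF next_in(2)] by (auto simp: self_maps_def next_in_def)

text \<open>Recursion along \<kappa>: at stage \<open>i\<close> there are fewer than \<kappa>
  earlier values \<open>K (h j)\<close>, so regularity leaves room above all of them. The values of
  \<open>h\<close> serve as anchors with prescribed gaps.\<close>

lemma sparse_function:
  assumes "\<And>x. x \<in> Field \<kappa> \<Longrightarrow> K x \<in> Field \<kappa>"
  obtains h where "\<And>i. i \<in> Field \<kappa> \<Longrightarrow> (i, h i) \<in> \<kappa>"
    "\<And>i j. i \<in> Field \<kappa> \<Longrightarrow> j \<sqsubset> i \<Longrightarrow> K (h j) \<sqsubset> h i"
proof -
  define P where "P h i b \<longleftrightarrow> (i, b) \<in> \<kappa> \<and> (\<forall>j. j \<sqsubset> i \<longrightarrow> K (h j) \<sqsubset> b)" for h i b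
  define h where "h = wfrec (\<kappa> - Id) (\<lambda>h i. SOME b. P h i b)"
  \<comment> \<open>\<open>P h i\<close> consults \<open>h\<close> only strictly below
    \<open>i\<close>, so the truncation made by \<open>wfrec\<close> does not affect it.\<close>
  have P_cong: "P (cut h (\<kappa> - Id) i) i = P h i" for i
    by (auto simp: P_def fun_eq_iff cut_def lt_iff)
  have unf: "h i = (SOME b. P h i b)" for i
    unfolding h_def by (subst wfrec[OF wf_lt]) (simp add: P_cong[unfolded h_def])
  have "i \<in> Field \<kappa> \<longrightarrow> P h i (h i)" for i
  proof (induction i rule: wf_induct_rule[OF wf_lt])
    case (1 i)
    show ?case
    proof
      assume i: "i \<in> Field \<kappa>"
      have "K (h j) \<in> Field \<kappa>" if "j \<sqsubset> i" for j
      proof -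
        have "P h j (h j)" using 1 that lt_Field(1)[OF that] by (auto simp: lt_iff)
        then have "h j \<in> Field \<kappa>" by (auto simp: P_def Field_def)
        then show ?thesis using assms by blast
      qed
      then obtain b where b: "b \<in> Field \<kappa>" "\<And>j. j \<sqsubset> i \<Longrightarrow> K (h j) \<sqsubset> b"
        using bounded_image_underS[OF i, of "\<lambda>j. K (h j)"] by blast
      obtain c where "i \<sqsubset> c" "b \<sqsubset> c" using ex_gt2[OF i b(1)] .
      then have "P h i c" unfolding P_def using b(2) lt_trans lt_imp_le by blast
      then show "P h i (h i)" using someI[of "P h i"] unf[of i] by metis
    qed
  qed
  then show thesis using that unfolding P_def by blast
qed

text \<open>
  The witness \<open>S\<close> contains unboundedly many intervals \<open>(\<beta>, g \<beta>]\<close> and misses unboundedly many.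
\<close>

lemma splitting_set_of_function:
  assumes "g \<in> self_maps \<kappa>"
  shows "\<exists>S \<subseteq> Field \<kappa>. \<forall>A\<in>full_subsets \<kappa>. le_star \<kappa> (next_in A) g \<longrightarrow> splits \<kappa> S A"
proof -
  have g: "g x \<in> Field \<kappa>" if "x \<in> Field \<kappa>" for x
    using assms that by (auto simp: self_maps_def)
  \<comment> \<open>From an anchor \<open>x\<close>, the interval \<open>(x, g x]\<close> ends
    before \<open>c x\<close>, where the omitted interval \<open>(c x, g (c x)]\<close> starts;
    \<open>K x\<close> lies beyond both and bounds the next anchor from below.\<close>
  have "\<exists>c. \<forall>x\<in>Field \<kappa>. x \<sqsubset> c x \<and> g x \<sqsubset> c x"
    by (intro bchoice ballI) (metis ex_gt2 g)
  then obtain c where c: "\<And>x. x \<in> Field \<kappa> \<Longrightarrow> x \<sqsubset> c x" "\<And>x. x \<in> Field \<kappa> \<Longrightarrow> g x \<sqsubset> c x"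
    by blast
  have cF: "c x \<in> Field \<kappa>" if "x \<in> Field \<kappa>" for x
    using lt_Field(2)[OF c(1)[OF that]] .
  have "\<exists>K. \<forall>x\<in>Field \<kappa>. c x \<sqsubset> K x \<and> g (c x) \<sqsubset> K x"
    by (intro bchoice ballI) (metis ex_gt2 g cF)
  then obtain K where K: "\<And>x. x \<in> Field \<kappa> \<Longrightarrow> c x \<sqsubset> K x"
      "\<And>x. x \<in> Field \<kappa> \<Longrightarrow> g (c x) \<sqsubset> K x"
    by blast
  have KF: "K x \<in> Field \<kappa>" if "x \<in> Field \<kappa>" for x
    using lt_Field(2)[OF K(1)[OF that]] .
  obtain h where h: "\<And>i. i \<in> Field \<kappa> \<Longrightarrow> (i, h i) \<in> \<kappa>"
    "\<And>i j. i \<in> Field \<kappa> \<Longrightarrow> j \<sqsubset> i \<Longrightarrow> K (h j) \<sqsubset> h i"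
    by (rule sparse_function[of K, OF KF]) blast+
  have hF: "h i \<in> Field \<kappa>" if "i \<in> Field \<kappa>" for i
    using h(1)[OF that] by (auto simp: Field_def)
  define S where "S = {x. \<exists>i\<in>Field \<kappa>. h i \<sqsubset> x \<and> (x, g (h i)) \<in> \<kappa>}"
  \<comment> \<open>The omitted interval of anchor \<open>i\<close> meets no interval of
    \<open>S\<close>: that of \<open>i\<close> itself ends before \<open>c (h i)\<close>, those of
    smaller indices end before \<open>h i\<close>, and those of larger indices start beyond
    \<open>K (h i)\<close>.\<close>
  have gap: "x \<notin> S" if i: "i \<in> Field \<kappa>" and x: "c (h i) \<sqsubset> x" "(x, g (c (h i))) \<in> \<kappa>" for i x
  proof
    assume "x \<in> S"
    then obtain j where j: "j \<in> Field \<kappa>" "h j \<sqsubset> x" "(x, g (h j)) \<in> \<kappa>" by (auto simp: S_def)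
    have xj: "x \<sqsubset> c (h j)" using le_lt_trans[OF j(3) c(2)[OF hF[OF j(1)]]] .
    consider "j = i" | "j \<sqsubset> i" | "i \<sqsubset> j" using lt_or_le[OF i j(1)] lt_iff by blast
    then show False
    proof cases
      case 1
      then show False using lt_trans[OF x(1)] xj not_lt_self by metis
    next
      case 2
      have "x \<sqsubset> K (h j)" using lt_trans[OF xj K(1)[OF hF[OF j(1)]]] .
      also have "K (h j) \<sqsubset> h i" using h(2)[OF i 2] .
      finally (lt_trans) have "x \<sqsubset> c (h i)" by (rule lt_trans[OF _ c(1)[OF hF[OF i]]])
      then show False using lt_trans[OF x(1)] not_lt_self by metis
    next
      case 3
      have "x \<sqsubset> K (h i)" using le_lt_trans[OF x(2) K(2)[OF hF[OF i]]] .
      then have "x \<sqsubset> h j" by (rule lt_trans[OF _ h(2)[OF j(1) 3]])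
      then show False using lt_trans[OF j(2)] not_lt_self by metis
    qed
  qed
  have "splits \<kappa> S A" if A: "A \<in> full_subsets \<kappa>" "le_star \<kappa> (next_in A) g" for A
  proof -
    have cof: "cofinal A \<kappa>" using A(1) full_subsets_iff by blast
    obtain a0 where a0: "a0 \<in> Field \<kappa>" "\<And>b. (a0, b) \<in> \<kappa> \<Longrightarrow> (next_in A b, g b) \<in> \<kappa>"
      using A(2) unfolding le_star_def by blast
    \<comment> \<open>For large \<open>b\<close> the next element of \<open>A\<close> after
      \<open>b\<close> lies in \<open>(b, g b]\<close>. Taking \<open>b = h i\<close> yields a point
      of \<open>S\<close>, and \<open>b = c (h i)\<close> a point outside it.\<close>
    have "(\<exists>b\<in>S \<inter> A. a \<sqsubset> b) \<and> (\<exists>b\<in>A - S. a \<sqsubset> b)" if a: "a \<in> Field \<kappa>" for a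
    proof -
      obtain i where i: "a \<sqsubset> i" "a0 \<sqsubset> i" using ex_gt2[OF a a0(1)] .
      have iF: "i \<in> Field \<kappa>" using lt_Field(2)[OF i(1)] .
      have hi: "a \<sqsubset> h i" "a0 \<sqsubset> h i"
        using lt_le_trans[OF i(1) h(1)[OF iF]] lt_le_trans[OF i(2) h(1)[OF iF]] .
      have ci: "a \<sqsubset> c (h i)" "a0 \<sqsubset> c (h i)"
        using lt_trans[OF hi(1) c(1)[OF hF[OF iF]]] lt_trans[OF hi(2) c(1)[OF hF[OF iF]]] .
      let ?x = "next_in A (h i)" and ?y = "next_in A (c (h i))"
      have x: "?x \<in> A" "h i \<sqsubset> ?x" "(?x, g (h i)) \<in> \<kappa>"
        using next_in[OF cof hF[OF iF]] a0(2)[OF lt_imp_le[OF hi(2)]] .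
      have y: "?y \<in> A" "c (h i) \<sqsubset> ?y" "(?y, g (c (h i))) \<in> \<kappa>"
        using next_in[OF cof cF[OF hF[OF iF]]] a0(2)[OF lt_imp_le[OF ci(2)]] .
      have "?x \<in> S \<inter> A" using x iF by (auto simp: S_def)
      moreover have "?y \<in> A - S" using y gap[OF iF] by blast
      moreover have "a \<sqsubset> ?x" "a \<sqsubset> ?y" using lt_trans[OF hi(1) x(2)] lt_trans[OF ci(1) y(2)] .
      ultimately show ?thesis by blast
    qed
    then show ?thesis unfolding splits_def by (simp add: cofinalI)
  qed
  moreover have "S \<subseteq> Field \<kappa>" using lt_Field by (auto simp: S_def)
  ultimately show ?thesis by blast
qed

text \<open>A common bound of the functions \<open>next_in A\<close> would produce a single set
  splitting every \<open>A\<close>. This is \<b> \<le> \<r>.\<close>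

lemma unbounded_family_of_unsplit:
  assumes "unsplit_family \<kappa> \<A>"
  shows "unbounded_family \<kappa> (next_in ` \<A>)"
  unfolding unbounded_family_def
proof (intro conjI notI)
  have full: "\<A> \<subseteq> full_subsets \<kappa>" using assms by (simp add: unsplit_family_def)
  then show "next_in ` \<A> \<subseteq> self_maps \<kappa>" using next_in_self_maps full_subsets_iff by blast
  assume "\<exists>g\<in>self_maps \<kappa>. \<forall>f\<in>next_in ` \<A>. le_star \<kappa> f g"
  then obtain g where g: "g \<in> self_maps \<kappa>" "\<And>A. A \<in> \<A> \<Longrightarrow> le_star \<kappa> (next_in A) g"
    by blast
  then obtain S where "S \<subseteq> Field \<kappa>" "\<forall>A\<in>\<A>. splits \<kappa> S A"
    using splitting_set_of_function[OF g(1)] full by blast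
  then show False using assms unfolding unsplit_family_def by blast
qed

text \<open>One splitting set per dominating function suffices, since each \<open>next_in A\<close>
  is dominated. This is \<s> \<le> \<d>.\<close>

lemma splitting_family_of_dominating:
  assumes D: "dominating_family \<kappa> D"
  obtains \<A> where "splitting_family \<kappa> \<A>" "|\<A>| \<le>o |D|"
proof -
  have "\<exists>S. \<forall>g\<in>D. S g \<subseteq> Field \<kappa> \<and>
      (\<forall>A\<in>full_subsets \<kappa>. le_star \<kappa> (next_in A) g \<longrightarrow> splits \<kappa> (S g) A)"
    by (rule bchoice) (use splitting_set_of_function D in \<open>auto simp: dominating_family_def\<close>)
  then obtain S where S: "\<And>g. g \<in> D \<Longrightarrow> S g \<subseteq> Field \<kappa>"
    "\<And>g A. g \<in> D \<Longrightarrow> A \<in> full_subsets \<kappa> \<Longrightarrow> le_star \<kappa> (next_in A) g \<Longrightarrow> splits \<kappa> (S g) A"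
    by blast
  \<comment> \<open>Some \<open>S g\<close> may be bounded and must be discarded; nothing is lost,
    as a set that splits another is itself cofinal.\<close>
  have "splitting_family \<kappa> (S ` D \<inter> full_subsets \<kappa>)"
    unfolding splitting_family_def
  proof (intro conjI ballI)
    fix A assume A: "A \<in> full_subsets \<kappa>"
    then obtain g where g: "g \<in> D" "le_star \<kappa> (next_in A) g"
      using D next_in_self_maps full_subsets_iff unfolding dominating_family_def by blast
    have sp: "splits \<kappa> (S g) A" using S(2)[OF g(1) A g(2)] .
    then have "cofinal (S g) \<kappa>" unfolding splits_def cofinal_def by blast
    then have "S g \<in> full_subsets \<kappa>" using S(1)[OF g(1)] full_subsets_iff by blast
    then show "\<exists>B\<in>S ` D \<inter> full_subsets \<kappa>. splits \<kappa> B A" using sp g(1) by blast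
  qed blast
  moreover have "|S ` D \<inter> full_subsets \<kappa>| \<le>o |D|"
    using card_of_mono1[of "S ` D \<inter> full_subsets \<kappa>" "S ` D"] card_of_image ordLeq_transitive
    by blast
  ultimately show thesis using that by blast
qed

subsection \<open>Uniform ultrafilters\<close>

lemma uf_sets_cofinal:
  assumes "uniform_ultrafilter \<kappa> U" "A \<in> U"
  shows "A \<subseteq> Field \<kappa>" "cofinal A \<kappa>"
proof -
  have "A \<in> full_subsets \<kappa>"
    using assms by (auto simp: uniform_ultrafilter_def ultrafilter_on_def full_subsets_def)
  then show "A \<subseteq> Field \<kappa>" "cofinal A \<kappa>" by (simp_all add: full_subsets_iff)
qed

lemma uf_mono:
  assumes "uniform_ultrafilter \<kappa> U" "A \<in> U" "A \<subseteq> B" "B \<subseteq> Field \<kappa>"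
  shows "B \<in> U"
  using assms unfolding uniform_ultrafilter_def ultrafilter_on_def by meson

lemma uf_Int:
  assumes "uniform_ultrafilter \<kappa> U" "A \<in> U" "B \<in> U"
  shows "A \<inter> B \<in> U"
  using assms by (simp add: uniform_ultrafilter_def ultrafilter_on_def)

lemma uf_Compl:
  assumes "uniform_ultrafilter \<kappa> U" "A \<subseteq> Field \<kappa>" "A \<notin> U"
  shows "Field \<kappa> - A \<in> U"
  using assms unfolding uniform_ultrafilter_def ultrafilter_on_def by meson

lemma uf_nonempty:
  assumes "uniform_ultrafilter \<kappa> U" "A \<in> U"
  obtains x where "x \<in> A" "x \<in> Field \<kappa>"
proof -
  have "A \<noteq> {}" using assms unfolding uniform_ultrafilter_def ultrafilter_on_def by meson
  then show thesis using that uf_sets_cofinal(1)[OF assms] by blast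
qed

lemma uf_Diff_underS:
  assumes U: "uniform_ultrafilter \<kappa> U" and "A \<in> U" "b \<in> Field \<kappa>"
  shows "A - underS \<kappa> b \<in> U"
proof -
  have "underS \<kappa> b \<notin> U" using uf_sets_cofinal(2)[OF U] not_cofinal_underS assms(3) by blast
  then have "Field \<kappa> - underS \<kappa> b \<in> U" using uf_Compl[OF U] lt_Field(1) by blast
  then have "A \<inter> (Field \<kappa> - underS \<kappa> b) \<in> U" using uf_Int[OF U assms(2)] by blast
  then show ?thesis using uf_mono[OF U] uf_sets_cofinal(1)[OF U assms(2)] by blast
qed

text \<open>The ultrafilter contains \<open>X\<close> or its complement, so some base element is
  almost contained in one of them and is not split by \<open>X\<close>. Hence \<r> is at most every
  character.\<close>

lemma unsplit_family_of_base:
  assumes U: "uniform_ultrafilter \<kappa> U" and B: "uf_base \<kappa> U \<B>"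
  shows "unsplit_family \<kappa> \<B>"
  unfolding unsplit_family_def
proof (intro conjI notI)
  have "A \<in> full_subsets \<kappa>" if "A \<in> U" for A
    using uf_sets_cofinal[OF U that] by (simp add: full_subsets_iff)
  then show "\<B> \<subseteq> full_subsets \<kappa>" using B by (auto simp: uf_base_def)
next
  assume "\<exists>X \<subseteq> Field \<kappa>. \<forall>A\<in>\<B>. splits \<kappa> X A"
  then obtain X where X: "X \<subseteq> Field \<kappa>" "\<forall>A\<in>\<B>. splits \<kappa> X A" by blast
  have "X \<in> U \<or> Field \<kappa> - X \<in> U" using uf_Compl[OF U X(1)] by blast
  then obtain A where "A \<in> \<B>" "almost_subset \<kappa> A X \<or> almost_subset \<kappa> A (Field \<kappa> - X)"
    using B unfolding uf_base_def by metis
  then show False using X(2) not_splits_if_almost_subset by blast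
qed

text \<open>Guarantees that bases exist, so \<open>char_uf\<close> is a true minimum and not the
  default zero of \<open>min_card\<close>.\<close>

lemma uf_base_self: "uf_base \<kappa> U U"
  unfolding uf_base_def using almost_subset_refl by blast

lemma
  shows Card_order_char_uf: "Card_order (char_uf \<kappa> U)"
    and char_uf_le: "uf_base \<kappa> U \<B> \<Longrightarrow> char_uf \<kappa> U \<le>o |\<B>|"
    and char_uf_attained: "\<exists>\<B>. uf_base \<kappa> U \<B> \<and> char_uf \<kappa> U = |\<B>|"
proof -
  let ?S = "{|\<B>| |\<B>. uf_base \<kappa> U \<B>}"
  have "?S \<noteq> {}" "\<forall>r\<in>?S. Card_order r" using uf_base_self card_of_Card_order by auto
  note m = min_card_least[OF this, folded char_uf_def]
  show "Card_order (char_uf \<kappa> U)" and "uf_base \<kappa> U \<B> \<Longrightarrow> char_uf \<kappa> U \<le>o |\<B>|"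
    and "\<exists>\<B>. uf_base \<kappa> U \<B> \<and> char_uf \<kappa> U = |\<B>|"
    using m card_of_Card_order by auto
qed

section \<open>A minimal function unbounded modulo the ultrafilter\<close>

lemma ex_closed_representative:
  assumes U: "uniform_ultrafilter \<kappa> U" and compl: "complete_family \<kappa> U"
    and unc: "natLeq <o \<kappa>"
  obtains f where "\<And>x. x \<in> Field \<kappa> \<Longrightarrow> f x \<in> Field \<kappa>"
    and "\<And>a. a \<in> Field \<kappa> \<Longrightarrow> {x \<in> Field \<kappa>. a \<sqsubset> f x} \<in> U"
    and "\<And>g. g \<in> self_maps \<kappa> \<Longrightarrow> {x \<in> Field \<kappa>. \<forall>b. b \<sqsubset> f x \<longrightarrow> g b \<sqsubset> f x} \<in> U"
proof -
  \<comment> \<open>\<open>R\<close> is the strict order of the ultrapower, and \<open>Q\<close>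
    consists of the functions that exceed every constant modulo \<open>U\<close>.\<close>
  define R where "R = {(f, g). {x \<in> Field \<kappa>. f x \<sqsubset> g x} \<in> U}"
  define Q where "Q = {f. (\<forall>x\<in>Field \<kappa>. f x \<in> Field \<kappa>) \<and>
    (\<forall>a\<in>Field \<kappa>. {x \<in> Field \<kappa>. a \<sqsubset> f x} \<in> U)}"
  have "wf R"
    unfolding wf_iff_no_infinite_down_chain
  proof
    assume "\<exists>F. \<forall>n. (F (Suc n), F n) \<in> R"
    then obtain F where F: "\<And>n. {x \<in> Field \<kappa>. F (Suc n) x \<sqsubset> F n x} \<in> U"
      by (auto simp: R_def)
    let ?A = "\<lambda>n. {x \<in> Field \<kappa>. F (Suc n) x \<sqsubset> F n x}"
    \<comment> \<open>Countably many sets of \<open>U\<close> have a common point by completeness;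
      there an infinite \<open>R\<close>-descent would become an infinite descent in
      \<kappa>.\<close>
    have "|range ?A| <o \<kappa>"
      using card_of_image[of ?A UNIV] card_of_nat unc
      by (meson ordLeq_ordIso_trans ordLeq_ordLess_trans)
    then have "\<Inter>(range ?A) \<in> U"
      using compl F unfolding complete_family_def
        by (metis (no_types, lifting) UNIV_not_empty image_is_empty image_subsetI)
    then obtain x where "x \<in> \<Inter>(range ?A)" by (rule uf_nonempty[OF U])
    then have "(F (Suc n) x, F n x) \<in> \<kappa> - Id" for n by (auto simp: lt_iff)
    then have "\<exists>s. \<forall>n. (s (Suc n), s n) \<in> \<kappa> - Id" by (intro exI[of _ "\<lambda>n. F n x"] allI)
    then show False using wf_lt unfolding wf_iff_no_infinite_down_chain by blast
  qed
  moreover have "(\<lambda>x. x) \<in> Q"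
  proof -
    have "{x \<in> Field \<kappa>. a \<sqsubset> x} \<in> U" if a: "a \<in> Field \<kappa>" for a
    proof -
      obtain b where b: "a \<sqsubset> b" using ex_gt a by blast
      have "Field \<kappa> - underS \<kappa> b \<in> U"
        using uf_Diff_underS[OF U _ lt_Field(2)[OF b]] U
        by (simp add: uniform_ultrafilter_def ultrafilter_on_def)
      moreover have "a \<sqsubset> x" if "x \<in> Field \<kappa> - underS \<kappa> b" for x
        using lt_or_le[of x b] lt_Field(2)[OF b] lt_le_trans[OF b] that by auto
      ultimately show ?thesis by (elim uf_mono[OF U]) auto
    qed
    then show ?thesis by (simp add: Q_def)
  qed
  ultimately obtain f where f: "f \<in> Q" and min: "\<And>h. (h, f) \<in> R \<Longrightarrow> h \<notin> Q"
    by (rule wfE_min) blast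
  have "{x \<in> Field \<kappa>. \<forall>b. b \<sqsubset> f x \<longrightarrow> g b \<sqsubset> f x} \<in> U" (is "?D \<in> U")
    if g: "g \<in> self_maps \<kappa>" for g
  proof (rule ccontr)
    have gF: "g x \<in> Field \<kappa>" if "x \<in> Field \<kappa>" for x
      using g that by (auto simp: self_maps_def)
    assume "?D \<notin> U"
    then have E: "Field \<kappa> - ?D \<in> U" by (intro uf_Compl[OF U]) auto
    \<comment> \<open>On the bad set \<open>h\<close> picks a witness below \<open>f x\<close> that
      \<open>g\<close> sends out of \<open>f x\<close>. The default \<open>x\<close> elsewhere only
      keeps the values in the field.\<close>
    define h where "h x = (if x \<in> Field \<kappa> - ?D then SOME b. b \<sqsubset> f x \<and> \<not> g b \<sqsubset> f x else x)" for x
    have h: "h x \<sqsubset> f x \<and> \<not> g (h x) \<sqsubset> f x" if x: "x \<in> Field \<kappa> - ?D" for x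
    proof -
      have "\<exists>b. b \<sqsubset> f x \<and> \<not> g b \<sqsubset> f x" using x by blast
      from someI_ex[OF this] show ?thesis using x by (simp add: h_def)
    qed
    have hF: "h x \<in> Field \<kappa>" if "x \<in> Field \<kappa>" for x
      using h[of x] that lt_Field(1) by (cases "x \<in> ?D") (auto simp: h_def)
    have "{x \<in> Field \<kappa>. h x \<sqsubset> f x} \<in> U"
      by (rule uf_mono[OF U E]) (use h in auto)
    \<comment> \<open>By minimality \<open>h\<close> is bounded by some \<open>a\<close> on a set in
      \<open>U\<close>. There \<open>g (h x)\<close> lies below a fixed \<open>b\<close>, by
      regularity, whereas \<open>f x\<close> exceeds \<open>b\<close> modulo \<open>U\<close>,
      contradicting the choice of \<open>h x\<close>. The point \<open>a'\<close> turns the weak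
      bound \<open>a\<close> into a strict one.\<close>
    then have "h \<notin> Q" using min by (simp add: R_def)
    then obtain a where a: "a \<in> Field \<kappa>" "{x \<in> Field \<kappa>. a \<sqsubset> h x} \<notin> U"
      using hF by (auto simp: Q_def)
    obtain a' where a': "a \<sqsubset> a'" using ex_gt[OF a(1)] .
    obtain b where b: "b \<in> Field \<kappa>" "\<And>x. x \<sqsubset> a' \<Longrightarrow> g x \<sqsubset> b"
      using bounded_image_underS[OF lt_Field(2)[OF a'], of g] gF[OF lt_Field(1)] by blast
    have "Field \<kappa> - {x \<in> Field \<kappa>. a \<sqsubset> h x} \<in> U"
      by (intro uf_Compl[OF U _ a(2)]) auto
    then have "(Field \<kappa> - {x \<in> Field \<kappa>. a \<sqsubset> h x}) \<inter> (Field \<kappa> - ?D) \<inter> {x \<in> Field \<kappa>. b \<sqsubset> f x} \<in> U"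
      using f b(1) E by (intro uf_Int[OF U]) (simp_all add: Q_def)
    then obtain x where x: "x \<in> Field \<kappa>" "\<not> a \<sqsubset> h x" "x \<in> Field \<kappa> - ?D" "b \<sqsubset> f x"
      by (rule uf_nonempty[OF U]) blast
    have "h x \<sqsubset> a'"
      using lt_or_le[OF a(1) hF[OF x(1)]] x(2) le_lt_trans[OF _ a'] by blast
    then have "g (h x) \<sqsubset> f x" using lt_trans[OF b(2) x(4)] by blast
    then show False using h[OF x(3)] by blast
  qed
  then show thesis using that f by (auto simp: Q_def)
qed

text \<open>A Galois-Tukey connection from functions under \<open>le_star\<close> to
  \<open>U\<close> under reverse almost inclusion: \<open>D\<close> goes from functions to sets and
  \<open>n\<close> returns. It carries pseudo-intersections to bounds and bases to dominating
  families.\<close>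

lemma ex_dominating_assignment:
  assumes U: "uniform_ultrafilter \<kappa> U" and compl: "complete_family \<kappa> U"
    and unc: "natLeq <o \<kappa>"
  obtains D n where "\<And>g. g \<in> self_maps \<kappa> \<Longrightarrow> D g \<in> U"
    and "\<And>A. A \<in> U \<Longrightarrow> n A \<in> self_maps \<kappa>"
    and "\<And>g A. g \<in> self_maps \<kappa> \<Longrightarrow> A \<in> U \<Longrightarrow> almost_subset \<kappa> A (D g) \<Longrightarrow> le_star \<kappa> g (n A)"
proof -
  obtain f where fF: "\<And>x. x \<in> Field \<kappa> \<Longrightarrow> f x \<in> Field \<kappa>"
    and f: "\<And>a. a \<in> Field \<kappa> \<Longrightarrow> {x \<in> Field \<kappa>. a \<sqsubset> f x} \<in> U"
    and D: "\<And>g. g \<in> self_maps \<kappa> \<Longrightarrow> {x \<in> Field \<kappa>. \<forall>b. b \<sqsubset> f x \<longrightarrow> g b \<sqsubset> f x} \<in> U"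
    using ex_closed_representative[OF assms] by blast
  define D where "D g = {x \<in> Field \<kappa>. \<forall>b. b \<sqsubset> f x \<longrightarrow> g b \<sqsubset> f x}" for g
  have cof: "cofinal (f ` A) \<kappa>" if A: "A \<in> U" for A
  proof (rule cofinalI)
    fix a assume "a \<in> Field \<kappa>"
    then have "A \<inter> {x \<in> Field \<kappa>. a \<sqsubset> f x} \<in> U" using f A uf_Int[OF U] by blast
    then show "\<exists>b\<in>f ` A. a \<sqsubset> b" by (rule uf_nonempty[OF U]) blast
  qed
  have "le_star \<kappa> g (next_in (f ` A))"
    if g: "g \<in> self_maps \<kappa>" and A: "A \<in> U" and AD: "almost_subset \<kappa> A (D g)" for g A
  proof -
    obtain a where a: "a \<in> Field \<kappa>" "A - underS \<kappa> a \<subseteq> D g"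
      using AD unfolding almost_subset_def by blast
    \<comment> \<open>Past \<open>b\<close>, a value \<open>f x\<close> can only come from
      \<open>x\<close> outside the exceptional segment below \<open>a\<close>, hence from
      \<open>x\<close> in \<open>D g\<close>; closure of \<open>f x\<close> under \<open>g\<close>
      then bounds \<open>g c\<close>.\<close>
    obtain b where b: "b \<in> Field \<kappa>" "\<And>x. x \<sqsubset> a \<Longrightarrow> f x \<sqsubset> b"
      using bounded_image_underS[OF a(1), of f] lt_Field(1) fF by blast
    have "(g c, next_in (f ` A) c) \<in> \<kappa>" if c: "(b, c) \<in> \<kappa>" for c
    proof -
      have cF: "c \<in> Field \<kappa>" using c by (auto simp: Field_def)
      obtain x where x: "x \<in> A" "next_in (f ` A) c = f x"
        using next_in(1)[OF cof[OF A] cF] by blast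
      have cx: "c \<sqsubset> f x" using next_in(2)[OF cof[OF A] cF] x(2) by simp
      have "\<not> x \<sqsubset> a" using b(2) cx c le_lt_trans lt_trans not_lt_self by blast
      then have "x \<in> D g" using x(1) a(2) by blast
      then show ?thesis using cx x(2) lt_imp_le by (simp add: D_def)
    qed
    then show ?thesis using b(1) unfolding le_star_def by blast
  qed
  then show thesis
    using that[of D "\<lambda>A. next_in (f ` A)"] D cof next_in_self_maps unfolding D_def by blast
qed

end

subsection \<open>Simple P-points\<close>

text \<open>The length and the ultrafilter are parameters so that the results can be instantiated
  again for a second length.\<close>

locale simple_P_point_above = regular_order \<kappa> for \<kappa> :: "'a rel" +
  fixes lam :: "'b rel" and U :: "'a set set"
  assumes uncountable: "natLeq <o \<kappa>" and lam_regular: "regular_cardinal lam"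
    and above: "\<kappa> <o lam" and P_point: "simple_P_point lam \<kappa> U"
begin

lemma U: "uniform_ultrafilter \<kappa> U"
  using P_point by (simp add: simple_P_point_def)

lemma lam_WO: "Well_order lam" and lam_Card: "Card_order lam"
  using lam_regular card_order_on_well_order_on by (auto simp: regular_cardinal_def)

text \<open>Each member of the family almost contains some term of the generating sequence.
  Regularity of \<open>lam\<close> puts an index strictly above all those used, and the term there
  works for the whole family.\<close>

lemma pseudo_intersection:
  assumes A: "\<A> \<subseteq> U" "|\<A>| <o lam"
  obtains B where "B \<in> U" "\<And>A. A \<in> \<A> \<Longrightarrow> almost_subset \<kappa> B A"
proof -
  interpret lam: regular_order lam by standard (rule lam_regular)
  obtain X where X: "\<And>i. i \<in> Field lam \<Longrightarrow> X i \<in> U"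
    "\<And>i j. (i, j) \<in> lam \<Longrightarrow> i \<noteq> j \<Longrightarrow> almost_subset \<kappa> (X j) (X i)"
    "uf_base \<kappa> U (X ` Field lam)"
    using P_point unfolding simple_P_point_def by blast
  have "\<exists>i. \<forall>A\<in>\<A>. i A \<in> Field lam \<and> almost_subset \<kappa> (X (i A)) A"
    by (rule bchoice) (use X(3) A(1) in \<open>unfold uf_base_def, blast\<close>)
  then obtain i where i: "\<And>A. A \<in> \<A> \<Longrightarrow> i A \<in> Field lam"
    "\<And>A. A \<in> \<A> \<Longrightarrow> almost_subset \<kappa> (X (i A)) A" by blast
  have "|i ` \<A>| <o lam" using card_of_image A(2) ordLeq_ordLess_trans by blast
  then obtain j where j: "j \<in> Field lam" "\<And>k. k \<in> i ` \<A> \<Longrightarrow> lam.lt k j"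
    using lam.bounded_if_small[of "i ` \<A>"] i(1) by blast
  have "almost_subset \<kappa> (X j) A" if "A \<in> \<A>" for A
    using almost_subset_trans[OF WO X(2) i(2)[OF that]] j(2)[of "i A"] that
    by (simp add: lam.lt_iff)
  then show thesis using that X(1)[OF j(1)] by blast
qed

text \<open>Since \<kappa> is below \<open>lam\<close>, a family of fewer than \<kappa> sets has a
  pseudo-intersection \<open>B\<close>. Regularity of \<kappa> bounds the exceptional segments
  together, so one tail of \<open>B\<close> lies in the whole intersection.\<close>

lemma complete: "complete_family \<kappa> U"
  unfolding complete_family_def
proof (intro allI impI, elim conjE)
  fix F assume F: "F \<subseteq> U" "F \<noteq> {}" "|F| <o \<kappa>"
  obtain B where B: "B \<in> U" "\<And>A. A \<in> F \<Longrightarrow> almost_subset \<kappa> B A"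
    using pseudo_intersection[OF F(1)] ordLess_transitive[OF F(3) above] by blast
  have "\<exists>a. \<forall>A\<in>F. a A \<in> Field \<kappa> \<and> B - underS \<kappa> (a A) \<subseteq> A"
    by (rule bchoice) (use B(2) in \<open>unfold almost_subset_def, blast\<close>)
  then obtain a where a: "\<And>A. A \<in> F \<Longrightarrow> a A \<in> Field \<kappa>"
    "\<And>A. A \<in> F \<Longrightarrow> B - underS \<kappa> (a A) \<subseteq> A" by blast
  have "|a ` F| <o \<kappa>" using card_of_image F(3) ordLeq_ordLess_trans by blast
  then obtain b where b: "b \<in> Field \<kappa>" "\<And>x. x \<in> a ` F \<Longrightarrow> x \<sqsubset> b"
    using bounded_if_small[of "a ` F"] a(1) by blast
  have "B - underS \<kappa> b \<subseteq> A" if "A \<in> F" for A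
    using a(2)[OF that] b(2)[of "a A"] that lt_trans by blast
  then have "B - underS \<kappa> b \<subseteq> \<Inter>F" by blast
  moreover have "\<Inter>F \<subseteq> Field \<kappa>" using F uf_sets_cofinal(1)[OF U] by blast
  ultimately show "\<Inter>F \<in> U" using uf_mono[OF U uf_Diff_underS[OF U B(1) b(1)]] by blast
qed

lemma ex_base: obtains \<B> where "uf_base \<kappa> U \<B>" "|\<B>| \<le>o lam"
proof -
  obtain X where "uf_base \<kappa> U (X ` Field lam)"
    using P_point unfolding simple_P_point_def by blast
  moreover have "|X ` Field lam| \<le>o lam"
    using card_of_image card_of_Field_ordIso[OF lam_Card] ordLeq_ordIso_trans by blast
  ultimately show thesis using that by blast
qed

section \<open>Lower bounds, and a dominating family of size at most \<open>lam\<close>\<close>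

lemma splitting_family_ge:
  assumes A: "splitting_family \<kappa> \<A>" shows "lam \<le>o |\<A>|"
proof (rule ccontr)
  assume "\<not> lam \<le>o |\<A>|"
  then have small: "|\<A>| <o lam" using not_ordLeq_iff_ordLess[OF card_of_Well_order lam_WO] by blast
  \<comment> \<open>Each set is replaced by whichever of it and its complement lies in
    \<open>U\<close>; a pseudo-intersection of these choices is split by no member of the
    family.\<close>
  let ?c = "\<lambda>A. if A \<in> U then A else Field \<kappa> - A"
  have "?c ` \<A> \<subseteq> U"
    using A uf_Compl[OF U] by (auto simp: splitting_family_def full_subsets_def)
  moreover have "|?c ` \<A>| <o lam" using card_of_image small ordLeq_ordLess_trans by blast
  ultimately obtain B where B: "B \<in> U" "\<And>A. A \<in> ?c ` \<A> \<Longrightarrow> almost_subset \<kappa> B A"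
    using pseudo_intersection by blast
  have "B \<in> full_subsets \<kappa>" using uf_sets_cofinal[OF U B(1)] full_subsets_iff by blast
  then obtain A where "A \<in> \<A>" "splits \<kappa> A B" using A unfolding splitting_family_def by blast
  moreover have "almost_subset \<kappa> B (?c A)" using B(2) \<open>A \<in> \<A>\<close> by blast
  ultimately show False using not_splits_if_almost_subset by (metis (full_types))
qed

lemma unbounded_family_ge:
  assumes F: "unbounded_family \<kappa> F" shows "lam \<le>o |F|"
proof (rule ccontr)
  assume "\<not> lam \<le>o |F|"
  then have small: "|F| <o lam" using not_ordLeq_iff_ordLess[OF card_of_Well_order lam_WO] by blast
  obtain D n where D: "\<And>g. g \<in> self_maps \<kappa> \<Longrightarrow> D g \<in> U"
    and n: "\<And>A. A \<in> U \<Longrightarrow> n A \<in> self_maps \<kappa>"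
      "\<And>g A. g \<in> self_maps \<kappa> \<Longrightarrow> A \<in> U \<Longrightarrow> almost_subset \<kappa> A (D g) \<Longrightarrow> le_star \<kappa> g (n A)"
    using ex_dominating_assignment[OF U complete uncountable] by metis
  have sm: "F \<subseteq> self_maps \<kappa>" using F by (simp add: unbounded_family_def)
  have "|D ` F| <o lam" using card_of_image small ordLeq_ordLess_trans by blast
  moreover have "D ` F \<subseteq> U" using D sm by blast
  \<comment> \<open>One \<open>B\<close> almost contained in every \<open>D f\<close> makes
    \<open>n B\<close> a bound for the whole family.\<close>
  ultimately obtain B where "B \<in> U" "\<And>A. A \<in> D ` F \<Longrightarrow> almost_subset \<kappa> B A"
    using pseudo_intersection by blast
  then have "n B \<in> self_maps \<kappa>" "\<forall>f\<in>F. le_star \<kappa> f (n B)" using n sm by blast+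
  then show False using F unfolding unbounded_family_def by blast
qed

lemma ex_dominating_family: obtains D where "dominating_family \<kappa> D" "|D| \<le>o lam"
proof -
  obtain D n where D: "\<And>g. g \<in> self_maps \<kappa> \<Longrightarrow> D g \<in> U"
    and n: "\<And>A. A \<in> U \<Longrightarrow> n A \<in> self_maps \<kappa>"
      "\<And>g A. g \<in> self_maps \<kappa> \<Longrightarrow> A \<in> U \<Longrightarrow> almost_subset \<kappa> A (D g) \<Longrightarrow> le_star \<kappa> g (n A)"
    using ex_dominating_assignment[OF U complete uncountable] by metis
  obtain \<B> where B: "uf_base \<kappa> U \<B>" "|\<B>| \<le>o lam" using ex_base .
  have "dominating_family \<kappa> (n ` \<B>)"
    unfolding dominating_family_def
  proof (intro conjI ballI)
    show "n ` \<B> \<subseteq> self_maps \<kappa>" using B(1) n(1) unfolding uf_base_def by blast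
    fix g assume g: "g \<in> self_maps \<kappa>"
    then obtain A where "A \<in> \<B>" "A \<in> U" "almost_subset \<kappa> A (D g)"
      using D B(1) unfolding uf_base_def by blast
    then show "\<exists>f\<in>n ` \<B>. le_star \<kappa> g f" using n(2)[OF g] by blast
  qed
  moreover have "|n ` \<B>| \<le>o lam" using card_of_image B(2) ordLeq_transitive by blast
  ultimately show thesis using that by blast
qed

lemma unsplit_family_ge:
  assumes "unsplit_family \<kappa> \<A>" shows "lam \<le>o |\<A>|"
  using unbounded_family_ge[OF unbounded_family_of_unsplit[OF assms]] card_of_image
    ordLeq_transitive by blast

lemma char_uf_ge:
  assumes "uniform_ultrafilter \<kappa> W" shows "lam \<le>o char_uf \<kappa> W"
  using char_uf_attained[of W] unsplit_family_of_base[OF assms] unsplit_family_ge by metis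

lemma char_uf_P_point: "char_uf \<kappa> U \<le>o lam"
  using ex_base char_uf_le ordLeq_transitive by metis

section \<open>Values of the six invariants\<close>

lemma u_card: "u_card \<kappa> =o lam"
  unfolding u_card_def
  by (rule min_card_ordIsoI[where r = "char_uf \<kappa> U"])
    (use char_uf_ge Card_order_char_uf char_uf_P_point U in auto)

lemma u_com_card: "u_com_card \<kappa> =o lam"
  unfolding u_com_card_def
  by (rule min_card_ordIsoI[where r = "char_uf \<kappa> U"])
    (use char_uf_ge Card_order_char_uf char_uf_P_point U complete in auto)

lemma r_card: "r_card \<kappa> =o lam"
proof -
  obtain \<B> where B: "uf_base \<kappa> U \<B>" "|\<B>| \<le>o lam" using ex_base .
  show ?thesis unfolding r_card_def
    by (rule min_card_ordIsoI[where r = "|\<B>|"])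
      (use unsplit_family_of_base[OF U B(1)] B(2) unsplit_family_ge card_of_Card_order in auto)
qed

lemma b_card: "b_card \<kappa> =o lam"
proof -
  obtain \<B> where B: "uf_base \<kappa> U \<B>" "|\<B>| \<le>o lam" using ex_base .
  \<comment> \<open>The upper bound for \<b> uses that a base is unsplit, so its next-element
    functions form an unbounded family.\<close>
  have "|next_in ` \<B>| \<le>o lam" using card_of_image B(2) ordLeq_transitive by blast
  then show ?thesis unfolding b_card_def
    by (intro min_card_ordIsoI[where r = "|next_in ` \<B>|"])
      (use unbounded_family_of_unsplit[OF unsplit_family_of_base[OF U B(1)]]
        unbounded_family_ge card_of_Card_order in auto)
qed

lemma s_card: "s_card \<kappa> =o lam"
proof -
  obtain D where D: "dominating_family \<kappa> D" "|D| \<le>o lam" using ex_dominating_family .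
  obtain \<A> where A: "splitting_family \<kappa> \<A>" "|\<A>| \<le>o |D|"
    using splitting_family_of_dominating[OF D(1)] .
  have "|\<A>| \<le>o lam" using ordLeq_transitive[OF A(2) D(2)] .
  then show ?thesis unfolding s_card_def
    by (intro min_card_ordIsoI[where r = "|\<A>|"]) (use A(1) splitting_family_ge card_of_Card_order in auto)
qed

lemma d_card: "d_card \<kappa> =o lam"
proof -
  obtain D where D: "dominating_family \<kappa> D" "|D| \<le>o lam" using ex_dominating_family .
  \<comment> \<open>The lower bound for \<d> comes from \<s>: a dominating family yields a splitting
    family that is no larger.\<close>
  have "lam \<le>o |E|" if "dominating_family \<kappa> E" for E
    using splitting_family_of_dominating[OF that] splitting_family_ge ordLeq_transitive by metis
  then show ?thesis unfolding d_card_def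
    by (intro min_card_ordIsoI[where r = "|D|"]) (use D card_of_Card_order in auto)
qed

end

theorem theorem1p1:
  fixes \<kappa> :: "'a rel" and lam :: "'b rel" and \<mu> :: "'c rel"
  assumes "regular_cardinal \<kappa>" and "uncountable_cardinal \<kappa>"
    and "regular_cardinal lam" and "uncountable_cardinal lam"
    and "\<kappa> <o lam"
    and "\<exists>U. simple_P_point lam \<kappa> U"
  shows "(u_card \<kappa> =o lam \<and> u_com_card \<kappa> =o lam \<and> b_card \<kappa> =o lam \<and>
          d_card \<kappa> =o lam \<and> s_card \<kappa> =o lam \<and> r_card \<kappa> =o lam) \<and>
         (regular_cardinal \<mu> \<and> \<not> \<mu> =o lam \<longrightarrow> \<not> (\<exists>U. simple_P_point \<mu> \<kappa> U))"
proof -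
  obtain U where P: "simple_P_point lam \<kappa> U" using assms(6) by blast
  interpret simple_P_point_above \<kappa> lam U
    using assms P by unfold_locales (auto simp: uncountable_cardinal_def)
  \<comment> \<open>The sequence of length \<mu> is a base of \<open>W\<close>, whose character is
    at least \<open>lam\<close>, so \<mu> also exceeds \<kappa>. The whole analysis then applies to
    \<mu>, and \<open>u_card \<kappa>\<close> equals both lengths.\<close>
  have "\<mu> =o lam" if mu: "regular_cardinal \<mu>" and W: "simple_P_point \<mu> \<kappa> W" for W
  proof -
    obtain X where X: "uniform_ultrafilter \<kappa> W" "uf_base \<kappa> W (X ` Field \<mu>)"
      using W unfolding simple_P_point_def by blast
    have "Card_order \<mu>" using mu by (simp add: regular_cardinal_def)
    then have le: "|X ` Field \<mu>| \<le>o \<mu>"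
      using card_of_image card_of_Field_ordIso ordLeq_ordIso_trans by blast
    have "lam \<le>o \<mu>"
      using ordLeq_transitive[OF ordLeq_transitive[OF char_uf_ge[OF X(1)] char_uf_le[OF X(2)]] le] .
    then have "\<kappa> <o \<mu>" using above ordLess_ordLeq_trans by blast
    then interpret mu: simple_P_point_above \<kappa> \<mu> W
      using mu W uncountable by unfold_locales auto
    show ?thesis using mu.u_card u_card ordIso_symmetric ordIso_transitive by blast
  qed
  then show ?thesis using u_card u_com_card b_card d_card s_card r_card by blast
qed

end
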